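(* Let $X$ be any (real or complex) separable infinite-dimensional Banach space. There exists a recurrent operator $T:X\longrightarrow X$ whose set of recurrent vectors $\mathrm{Rec}(T)$ is not dense lineable.
   Context: An operator on a Banach space $X$ is a continuous linear map $T:X\longrightarrow X$. A vector $x\in X$ is recurrent for $T$ if $x\in\overline{\{T^nx \ ;\ n\geq 1\}}$. $\mathrm{Rec}(T)$ denotes the set of recurrent vectors for $T$, and $T$ is called a recurrent operator if $\mathrm{Rec}(T)$ is dense in $X$. The set $\mathrm{Rec}(T)$ is called dense lineable if it contains a vector subspace of $X$ that is dense in $X$. *)

theory Defs
  imports "HOL-Analysis.Analysis"
begin

(* The library has no class of complex normed spaces.  A Banach space over the
   scalar field 'k is a type of class banach, i.e. a complete real normed space,
   with a scalar multiplication by 'k that extends the real one and for which the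
   norm is absolutely homogeneous.  It is used for 'k = real, where smul is forced
   to be scaleR, and for 'k = complex; any complex Banach space is of this form,
   since it is a real Banach space by restriction of scalars. *)

locale banach_space_over = vector_space smul
  for smul :: "'k::real_normed_field \<Rightarrow> 'a::banach \<Rightarrow> 'a" +
  assumes smul_of_real: "smul (of_real r) x = r *\<^sub>R x"
    and norm_smul: "norm (smul c x) = norm c * norm x"

lemma banach_space_over_real: "banach_space_over (scaleR :: real \<Rightarrow> 'a::banach \<Rightarrow> 'a)"
  by unfold_locales simp_all

lemma banach_space_over_complex: "banach_space_over ((*) :: complex \<Rightarrow> complex \<Rightarrow> complex)"
  by unfold_locales (simp_all add: algebra_simps norm_mult scaleR_conv_of_real)

(* In the following definitions, smul determines the scalar field with respect
   to which span, linear and subspace are understood. *)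

definition infinite_dimensional :: "('k::field \<Rightarrow> 'a::ab_group_add \<Rightarrow> 'a) \<Rightarrow> bool"
  where "infinite_dimensional smul \<longleftrightarrow> \<not> (\<exists>B. finite B \<and> module.span smul B = UNIV)"

definition bounded_operator :: "('k::field \<Rightarrow> 'a::real_normed_vector \<Rightarrow> 'a) \<Rightarrow> ('a \<Rightarrow> 'a) \<Rightarrow> bool"
  where "bounded_operator smul T \<longleftrightarrow>
    Vector_Spaces.linear smul smul T \<and> continuous_on UNIV T"

definition Rec :: "('a::topological_space \<Rightarrow> 'a) \<Rightarrow> 'a set"
  where "Rec T = {x. x \<in> closure {(T ^^ n) x | n. n \<ge> 1}}"

definition recurrent_operator :: "('k::field \<Rightarrow> 'a::real_normed_vector \<Rightarrow> 'a) \<Rightarrow> ('a \<Rightarrow> 'a) \<Rightarrow> bool"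
  where "recurrent_operator smul T \<longleftrightarrow> bounded_operator smul T \<and> closure (Rec T) = UNIV"

definition dense_lineable :: "('k::field \<Rightarrow> 'a::real_normed_vector \<Rightarrow> 'a) \<Rightarrow> 'a set \<Rightarrow> bool"
  where "dense_lineable smul A \<longleftrightarrow>
    (\<exists>V. module.subspace smul V \<and> V \<subseteq> A \<and> closure V = UNIV)"

lemma bounded_operator_real:
  fixes T :: "'a::real_normed_vector \<Rightarrow> 'a"
  shows "bounded_operator scaleR T \<longleftrightarrow> linear T \<and> continuous_on UNIV T"
  unfolding bounded_operator_def linear_def ..

lemma dense_lineable_real:
  fixes A :: "'a::real_normed_vector set"
  shows "dense_lineable scaleR A \<longleftrightarrow> (\<exists>V. subspace V \<and> V \<subseteq> A \<and> closure V = UNIV)"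
  unfolding dense_lineable_def subspace_raw_def ..

lemma infinite_dimensional_real:
  "infinite_dimensional (scaleR :: real \<Rightarrow> 'a::real_vector \<Rightarrow> 'a) \<longleftrightarrow>
    \<not> (\<exists>B::'a set. finite B \<and> span B = UNIV)"
  unfolding infinite_dimensional_def span_raw_def ..

end

theory Submission
  imports Defs
begin

text \<open>The operator is a small perturbation of the identity on a space with a biorthogonal
  sequence whose span is dense (theorem \<open>fundamental_biorthogonal_sequence\<close>). Two of the basis
  vectors, with coordinates \<open>\<phi>\<close> and \<open>\<psi>\<close>, are fixed by the operator up to what they add elsewhere; the others are
  grouped into planes. On the \<open>k\<close>-th plane the operator acts as a rotation of finite order
  \<open>M (Suc k)\<close>, and in addition it pushes a vector \<open>x\<close> in a fixed direction of that plane by an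
  amount proportional to \<open>\<phi> x - q k * \<psi> x\<close>. Both \<open>\<phi>\<close> and \<open>\<psi>\<close> are invariant, so along an orbit the same
  push is repeated and rotated. Over a full turn the pushes cancel, but over a sixth of a turn
  they add up.

  The periods increase rapidly and the scalars \<open>q k\<close> run through a countable dense set, each
  value occurring infinitely often. If \<open>x\<close> is a finite combination of basis vectors whose slope
  \<open>\<phi> x / \<psi> x\<close> equals \<open>q k\<close>, then at time \<open>M k\<close> the earlier planes have completed full turns, the \<open>k\<close>-th plane is not
  pushed, and the later planes have hardly moved; as \<open>q k\<close> recurs, \<open>x\<close> is recurrent
  (\<open>recurrent_point\<close>), and such \<open>x\<close> are dense. On the other hand, fix a slope \<open>\<alpha>\<close> different from all
  \<open>q k\<close>. The strength of the \<open>k\<close>-th push can be chosen in advance so large compared with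
  \<open>1 / norm (\<alpha> - q k)\<close> that for every vector of slope \<open>\<alpha>\<close> with \<open>\<psi> x \<noteq> 0\<close> the orbit is far out during
  the whole time from \<open>M k / 6\<close> to \<open>M (Suc k) / 6\<close>, with a bound tending to infinity with \<open>k\<close>. These
  time intervals cover everything, so the orbit escapes and \<open>x\<close> is not recurrent
  (\<open>escaping_point\<close>). Finally, every dense subspace is mapped onto the whole plane by \<open>(\<phi>, \<psi>)\<close> and
  so contains such a vector (\<open>dense_subspace_meets_line\<close>).

  Since only rotations with real matrices are used, the real and the complex case are treated
  together. They differ in the one external ingredient, continuous functionals separating
  points, which comes from the Hahn-Banach theorem.\<close>

section \<open>The Hahn-Banach theorem and separating functionals\<close>

text \<open>The one-dimensional step of the Hahn-Banach theorem. A functional defined on a subspace is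
  represented by its graph, a subspace of the product with the real line; a subspace lying below
  the norm is automatically single-valued. The value \<open>c\<close> at
  the new vector has to satisfy the upper bounds \<open>norm (y + x) - r\<close> and the lower bounds
  \<open>s - norm (z - x)\<close>; the triangle inequality puts all lower bounds below all upper bounds, and
  the infimum of the upper bounds is chosen.\<close>

lemma norm_dominated_graph_extend:
  fixes G :: "('a::real_normed_vector \<times> real) set"
  assumes G: "subspace G" and dom: "\<And>y r. (y, r) \<in> G \<Longrightarrow> r \<le> norm y"
  obtains c where "\<And>y r. (y, r) \<in> span (insert (x, c) G) \<Longrightarrow> r \<le> norm y"
proof -
  define S where "S = (\<lambda>(y, r). norm (y + x) - r) ` G"
  define c where "c = Inf S"
  have cross: "s - norm (z - x) \<le> norm (y + x) - r" if "(y, r) \<in> G" "(z, s) \<in> G" for y r z s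
  proof -
    have "(y + z, r + s) \<in> G"
      using subspace_add[OF G that] by simp
    then have "r + s \<le> norm (y + z)" by (rule dom)
    also have "\<dots> = norm ((y + x) + (z - x))" by simp
    also have "\<dots> \<le> norm (y + x) + norm (z - x)" by (rule norm_triangle_ineq)
    finally show ?thesis by simp
  qed
  have zero: "(0, 0) \<in> G" using subspace_0[OF G] by (simp add: zero_prod_def)
  have bdd: "bdd_below S"
    unfolding S_def bdd_below_def using cross[OF _ zero] by (auto intro!: exI)
  have upper: "c \<le> norm (y + x) - r" if "(y, r) \<in> G" for y r
    unfolding c_def using that bdd by (intro cInf_lower) (auto simp: S_def)
  have lower: "s - norm (z - x) \<le> c" if "(z, s) \<in> G" for z s
    unfolding c_def using that zero cross by (intro cInf_greatest) (auto simp: S_def)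
  have key: "r + t * c \<le> norm (y + t *\<^sub>R x)" if yr: "(y, r) \<in> G" for y r t
  proof -
    have scaled: "(u *\<^sub>R y, u * r) \<in> G" for u
      using subspace_scale[OF G yr, of u] by simp
    consider "t = 0" | "t > 0" | "t < 0" by linarith
    then show ?thesis
    proof cases
      case 1
      then show ?thesis using dom[OF yr] by simp
    next
      case 2
      have "c \<le> norm ((1/t) *\<^sub>R y + x) - (1/t) * r"
        by (rule upper[OF scaled])
      then have "t * c \<le> t * norm ((1/t) *\<^sub>R y + x) - r"
        using 2 by (simp add: field_simps)
      also have "t * norm ((1/t) *\<^sub>R y + x) = norm (t *\<^sub>R ((1/t) *\<^sub>R y + x))"
        using 2 by simp
      also have "t *\<^sub>R ((1/t) *\<^sub>R y + x) = y + t *\<^sub>R x"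
        using 2 by (simp add: scaleR_add_right)
      finally show ?thesis by simp
    next
      case 3
      have "(- 1/t) * r - norm ((- 1/t) *\<^sub>R y - x) \<le> c"
        by (rule lower[OF scaled])
      then have "(-t) * ((- 1/t) * r - norm ((- 1/t) *\<^sub>R y - x)) \<le> (-t) * c"
        using 3 by (intro mult_left_mono) auto
      then have "r - (-t) * norm ((- 1/t) *\<^sub>R y - x) \<le> - t * c"
        using 3 by (simp add: right_diff_distrib)
      moreover have "(-t) * norm ((- 1/t) *\<^sub>R y - x) = norm ((-t) *\<^sub>R ((- 1/t) *\<^sub>R y - x))"
        using 3 by simp
      moreover have "(-t) *\<^sub>R ((- 1/t) *\<^sub>R y - x) = y + t *\<^sub>R x"
        using 3 by (simp add: scaleR_diff_right)
      ultimately have "r - norm (y + t *\<^sub>R x) \<le> - t * c" by metis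
      then show ?thesis by simp
    qed
  qed
  have "r \<le> norm y" if yr: "(y, r) \<in> span (insert (x, c) G)" for y r
  proof -
    obtain t where "(y, r) - t *\<^sub>R (x, c) \<in> span G"
      using yr by (auto simp: span_insert)
    then have "(y - t *\<^sub>R x, r - t * c) \<in> G"
      by (simp only: span_eq_iff[THEN iffD2, OF G] diff_Pair scaleR_Pair real_scaleR_def)
    from key[OF this, of t] show ?thesis by simp
  qed
  then show ?thesis by (rule that)
qed

text \<open>Zorn's lemma gives a maximal dominated graph through \<open>(x0, norm x0)\<close>; by the extension step it is
  defined everywhere.\<close>

theorem Hahn_Banach_norming:
  fixes x0 :: "'a::real_normed_vector"
  obtains f where "linear f" "\<And>x. \<bar>f x\<bar> \<le> norm x" "f x0 = norm x0"
proof -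
  define \<A> where "\<A> = {G :: ('a \<times> real) set. subspace G \<and> (x0, norm x0) \<in> G \<and>
    (\<forall>y r. (y, r) \<in> G \<longrightarrow> r \<le> norm y)}"
  have start: "span {(x0, norm x0)} \<in> \<A>"
  proof -
    have "t * norm x0 \<le> norm (t *\<^sub>R x0)" for t
      by (simp add: mult_right_mono)
    then show ?thesis
      unfolding \<A>_def by (auto simp: subspace_span span_base) (auto simp: span_singleton)
  qed
  have "\<exists>G\<in>\<A>. \<forall>H\<in>\<A>. G \<subseteq> H \<longrightarrow> H = G"
  proof (rule subset_Zorn_nonempty)
    show "\<A> \<noteq> {}" using start by blast
  next
    fix \<C> assume ne: "\<C> \<noteq> {}" and chain: "subset.chain \<A> \<C>"
    have sub: "\<C> \<subseteq> \<A>" and lin: "\<And>G H. G \<in> \<C> \<Longrightarrow> H \<in> \<C> \<Longrightarrow> G \<subseteq> H \<or> H \<subseteq> G"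
      using chain by (auto simp: subset_chain_def)
    have subsp: "subspace G" if "G \<in> \<C>" for G using sub that by (auto simp: \<A>_def)
    have "subspace (\<Union>\<C>)"
    proof (rule subspaceI)
      show "0 \<in> \<Union>\<C>" using ne subsp subspace_0 by fastforce
    next
      fix u v assume "u \<in> \<Union>\<C>" "v \<in> \<Union>\<C>"
      then obtain G H where "G \<in> \<C>" "H \<in> \<C>" "u \<in> G" "v \<in> H" by blast
      with lin[of G H] subsp[of G] subsp[of H] show "u + v \<in> \<Union>\<C>"
        by (meson UnionI subsetD subspace_add)
    next
      fix c u assume "u \<in> \<Union>\<C>"
      with subsp show "c *\<^sub>R u \<in> \<Union>\<C>" by (meson Union_iff subspace_scale)
    qed
    then show "\<Union>\<C> \<in> \<A>" using ne sub by (auto simp: \<A>_def)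
  qed
  then obtain G where "G \<in> \<A>" and maximal: "\<And>H. H \<in> \<A> \<Longrightarrow> G \<subseteq> H \<Longrightarrow> H = G" by blast
  then have G: "subspace G" and x0: "(x0, norm x0) \<in> G"
    and dom: "\<And>y r. (y, r) \<in> G \<Longrightarrow> r \<le> norm y" by (auto simp: \<A>_def)
  have total: "\<exists>r. (x, r) \<in> G" for x
  proof -
    obtain c where c: "\<And>y r. (y, r) \<in> span (insert (x, c) G) \<Longrightarrow> r \<le> norm y"
      using norm_dominated_graph_extend[OF G dom] by blast
    have "G \<subseteq> span (insert (x, c) G)" by (meson span_superset subset_insertI subset_trans)
    moreover from this have "span (insert (x, c) G) \<in> \<A>"
      using c x0 by (auto simp: \<A>_def)
    ultimately have "span (insert (x, c) G) = G" using maximal by blast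
    then show ?thesis using span_base[of "(x, c)" "insert (x, c) G"] by auto
  qed
  have unique: "r = s" if "(x, r) \<in> G" "(x, s) \<in> G" for x r s
    using dom[of 0 "r - s"] dom[of 0 "s - r"]
      subspace_diff[OF G that] subspace_diff[OF G that(2,1)] by simp
  define f where "f x = (THE r. (x, r) \<in> G)" for x
  have f: "(x, f x) \<in> G" for x
    unfolding f_def using total[of x] unique by (metis theI)
  have "linear f"
  proof (rule linearI)
    show "f (x + y) = f x + f y" for x y
      using unique[OF f[of "x + y"]] subspace_add[OF G f[of x] f[of y]] by simp
    show "f (c *\<^sub>R x) = c *\<^sub>R f x" for c x
      using unique[OF f[of "c *\<^sub>R x"]] subspace_scale[OF G f[of x], of c] by simp
  qed
  moreover have "\<bar>f x\<bar> \<le> norm x" for x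
    using dom[OF f[of x]] dom[OF f[of "- x"]] linear_neg[OF \<open>linear f\<close>, of x] by simp
  moreover have "f x0 = norm x0"
    by (rule unique[OF f x0])
  ultimately show ?thesis by (rule that)
qed

context banach_space_over
begin

text \<open>Real boundedness and homogeneity over the scalar field are kept as two conditions, so that the
  facts on bounded linear maps over the reals apply directly.\<close>

definition dual_space :: "('a \<Rightarrow> 'k) set"
  where "dual_space = {f. bounded_linear f \<and> (\<forall>c x. f (smul c x) = c * f x)}"

lemma dual_space_bounded_linear: "f \<in> dual_space \<Longrightarrow> bounded_linear f"
  and dual_space_smul: "f \<in> dual_space \<Longrightarrow> f (smul c x) = c * f x"
  by (auto simp: dual_space_def)

lemma dual_space_add: "f \<in> dual_space \<Longrightarrow> f (x + y) = f x + f y"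
  and dual_space_diff: "f \<in> dual_space \<Longrightarrow> f (x - y) = f x - f y"
  and dual_space_zero: "f \<in> dual_space \<Longrightarrow> f 0 = 0"
  and dual_space_sum: "f \<in> dual_space \<Longrightarrow> f (\<Sum>i\<in>I. g i) = (\<Sum>i\<in>I. f (g i))"
  using dual_space_bounded_linear
  by (auto simp: linear_simps linear_sum bounded_linear.linear)

lemma dual_space_continuous: "f \<in> dual_space \<Longrightarrow> continuous_on S f"
  by (rule bounded_linear.continuous_on[OF dual_space_bounded_linear continuous_on_id])

lemma bounded_bilinear_smul: "bounded_bilinear smul"
proof
  show "smul (r *\<^sub>R c) x = r *\<^sub>R smul c x" for r c x
    by (simp add: scaleR_conv_of_real smul_of_real[symmetric])
  show "smul c (r *\<^sub>R x) = r *\<^sub>R smul c x" for r c x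
    by (simp add: smul_of_real[symmetric] mult.commute)
  show "\<exists>K. \<forall>c x. norm (smul c x) \<le> norm c * norm x * K"
    by (rule exI[of _ 1]) (simp add: norm_smul)
qed (rule scale_left_distrib scale_right_distrib)+

lemma dual_space_closed_under_combination:
  assumes "f \<in> dual_space" "\<And>i. i \<in> I \<Longrightarrow> g i \<in> dual_space"
  shows "(\<lambda>y. f y - (\<Sum>i\<in>I. c i * g i y)) \<in> dual_space"
proof -
  have "bounded_linear (\<lambda>y. f y - (\<Sum>i\<in>I. c i * g i y))"
    using assms dual_space_bounded_linear
    by (intro bounded_linear_sub bounded_linear_sum bounded_linear_const_mult) auto
  then show ?thesis
    using assms by (auto simp: dual_space_def algebra_simps sum_distrib_left)
qed

lemma dual_space_separates_normalized:
  assumes "\<And>x. x \<noteq> 0 \<Longrightarrow> \<exists>f\<in>dual_space. f x \<noteq> 0"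
  obtains g where "\<And>x. g x \<in> dual_space" "\<And>x. x \<noteq> 0 \<Longrightarrow> g x x = 1"
    "\<And>y. g 0 y = 0"
proof -
  have "\<exists>f\<in>dual_space. (x \<noteq> 0 \<longrightarrow> f x = 1) \<and> (x = 0 \<longrightarrow> (\<forall>y. f y = 0))" for x
  proof (cases "x = 0")
    case True
    have "(\<lambda>y. 0) \<in> dual_space" by (simp add: dual_space_def)
    then show ?thesis using True by auto
  next
    case False
    then obtain f where f: "f \<in> dual_space" "f x \<noteq> 0" using assms by blast
    have "(\<lambda>y. inverse (f x) * f y) \<in> dual_space"
      using f(1) by (simp add: dual_space_def bounded_linear_const_mult)
    then show ?thesis using f(2) False by (auto intro!: bexI[rotated])
  qed
  then obtain g where "\<forall>x. g x \<in> dual_space \<and> (x \<noteq> 0 \<longrightarrow> g x x = 1) \<and> (x = 0 \<longrightarrow> (\<forall>y. g x y = 0))"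
    by metis
  then show ?thesis by (intro that[of g]) auto
qed

end

lemma real_dual_separates_points:
  fixes x :: "'a::banach"
  assumes "x \<noteq> 0"
  shows "\<exists>f \<in> banach_space_over.dual_space (scaleR :: real \<Rightarrow> 'a \<Rightarrow> 'a). f x \<noteq> 0"
proof -
  interpret banach_space_over "scaleR :: real \<Rightarrow> 'a \<Rightarrow> 'a"
    by (rule banach_space_over_real)
  obtain f :: "'a \<Rightarrow> real" where f: "linear f" "\<And>x. \<bar>f x\<bar> \<le> norm x" "f x = norm x"
    using Hahn_Banach_norming[of x] by blast
  have "bounded_linear f"
    by (rule bounded_linear_intro[of _ 1]) (use f in \<open>auto simp: linear_add linear_cmul\<close>)
  then show ?thesis using f assms
    by (auto simp: dual_space_def linear_cmul intro!: bexI[of _ f])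
qed

text \<open>A complex-linear functional is recovered from its real part \<open>f\<close> as \<open>f y - \<i> * f (\<i> y)\<close>.\<close>

lemma complex_dual_separates_points:
  fixes smul :: "complex \<Rightarrow> 'a::banach \<Rightarrow> 'a"
  assumes "banach_space_over smul" and "x \<noteq> 0"
  shows "\<exists>f \<in> banach_space_over.dual_space smul. f x \<noteq> 0"
proof -
  interpret banach_space_over smul by fact
  obtain f :: "'a \<Rightarrow> real" where f: "linear f" "\<And>x. \<bar>f x\<bar> \<le> norm x" "f x = norm x"
    using Hahn_Banach_norming[of x] by blast
  define g where "g y = Complex (f y) (- f (smul \<i> y))" for y
  have split: "smul c y = Re c *\<^sub>R y + Im c *\<^sub>R smul \<i> y" for c y
  proof -
    have "smul c y = smul (of_real (Re c) + of_real (Im c) * \<i>) y"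
      by (metis complex_eq mult.commute)
    then show ?thesis
      by (simp only: scale_left_distrib smul_of_real scale_scale[symmetric])
  qed
  have ii: "smul \<i> (smul \<i> y) = - y" for y by simp
  have fcomb: "f (r *\<^sub>R y + s *\<^sub>R z) = r * f y + s * f z" for r s y z
    using f(1) by (simp add: linear_add linear_cmul)
  have hom: "g (smul c y) = c * g y" for c y
  proof -
    have "smul \<i> (smul c y) = smul c (smul \<i> y)" by (simp add: mult.commute)
    also have "\<dots> = Re c *\<^sub>R smul \<i> y + (- Im c) *\<^sub>R y" by (subst split) (simp only: ii, simp)
    finally have "f (smul \<i> (smul c y)) = Re c * f (smul \<i> y) - Im c * f y"
      by (simp only: fcomb)
    moreover have "f (smul c y) = Re c * f y + Im c * f (smul \<i> y)"
      by (subst split) (rule fcomb)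
    ultimately show ?thesis by (auto simp: g_def complex_eq_iff)
  qed
  have "bounded_linear g"
  proof (rule bounded_linear_intro[of _ 2])
    show "g (y + z) = g y + g z" for y z
      using f(1) by (simp add: g_def complex_eq_iff linear_add scale_right_distrib)
    show "g (r *\<^sub>R y) = r *\<^sub>R g y" for r y
      using hom[of "of_real r" y] by (simp add: smul_of_real scaleR_conv_of_real)
    show "norm (g y) \<le> norm y * 2" for y
      using cmod_le[of "g y"] f(2)[of y] f(2)[of "smul \<i> y"] by (simp add: g_def norm_smul)
  qed
  moreover have "g x \<noteq> 0" using assms f(3) by (simp add: g_def complex_eq_iff)
  ultimately show ?thesis using hom by (auto simp: dual_space_def)
qed

section \<open>Fundamental biorthogonal sequences\<close>

context banach_space_over
begin

context
  fixes x :: "nat \<Rightarrow> 'a" and g :: "'a \<Rightarrow> 'a \<Rightarrow> 'k"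
begin

text \<open>Vectors and functionals are produced together: each given vector is made invisible to the
  earlier functionals, and a functional \<open>g e\<close> that detects what remains is made to vanish on the
  earlier vectors. If nothing remains, \<open>e\<close> and, by the choice of \<open>g 0\<close>, its functional are zero;
  such indices are discarded afterwards, which spares a selection of independent vectors.\<close>

function gram_schmidt :: "nat \<Rightarrow> 'a \<times> ('a \<Rightarrow> 'k)" where
  "gram_schmidt n =
    (let e = x n - (\<Sum>i\<in>{..<n}. smul (snd (gram_schmidt i) (x n)) (fst (gram_schmidt i)))
     in (e, \<lambda>y. g e y - (\<Sum>i\<in>{..<n}. g e (fst (gram_schmidt i)) * snd (gram_schmidt i) y)))"
  by auto
termination by (relation less_than) auto

declare gram_schmidt.simps [simp del]

lemma gram_schmidt_vector:
  "fst (gram_schmidt n) =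
    x n - (\<Sum>i<n. smul (snd (gram_schmidt i) (x n)) (fst (gram_schmidt i)))"
  by (subst gram_schmidt.simps) (simp add: Let_def)

lemma gram_schmidt_functional:
  "snd (gram_schmidt n) =
    (\<lambda>y. g (fst (gram_schmidt n)) y -
      (\<Sum>i<n. g (fst (gram_schmidt n)) (fst (gram_schmidt i)) * snd (gram_schmidt i) y))"
  by (subst gram_schmidt.simps) (simp add: Let_def flip: gram_schmidt_vector)

lemma gram_schmidt_biorthogonal:
  assumes g: "\<And>z. g z \<in> dual_space" "\<And>z. z \<noteq> 0 \<Longrightarrow> g z z = 1" "\<And>y. g 0 y = 0"
  defines "e \<equiv> \<lambda>n. fst (gram_schmidt n)" and "f \<equiv> \<lambda>n. snd (gram_schmidt n)"
  shows "f n \<in> dual_space"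
    and "f i (e j) = (if i = j \<and> e j \<noteq> 0 then 1 else 0)"
    and "x n \<in> span (e ` {..n})"
proof -
  have e_rec: "e n = x n - (\<Sum>i<n. smul (f i (x n)) (e i))" for n
    using gram_schmidt_vector[of n] by (simp add: e_def f_def)
  have f_rec: "f n = (\<lambda>y. g (e n) y - (\<Sum>i<n. g (e n) (e i) * f i y))" for n
    using gram_schmidt_functional[of n] by (simp add: e_def f_def)
  have f: "f n \<in> dual_space" for n
    by (induction n rule: less_induct)
      (subst f_rec, rule dual_space_closed_under_combination, use g in auto)
  have "\<forall>i<n. \<forall>j<n. f i (e j) = (if i = j \<and> e j \<noteq> 0 then 1 else 0)" for n
  proof (induction n)
    case (Suc n)
    have left: "f i (e n) = 0" if i: "i < n" for i
    proof -
      have vanish: "f i (e i) * c = c * (if e i = 0 then 0 else 1)" for c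
        using Suc.IH i by simp
      have "f i (e n) = f i (x n) - (\<Sum>j<n. f j (x n) * f i (e j))"
        by (subst e_rec) (simp only: dual_space_diff[OF f] dual_space_sum[OF f] dual_space_smul[OF f])
      also have "(\<Sum>j<n. f j (x n) * f i (e j)) = (\<Sum>j<n. if j = i then f i (x n) * f i (e i) else 0)"
        using Suc.IH i by (intro sum.cong) auto
      also have "\<dots> = f i (x n) * f i (e i)" using i by simp
      also have "f i (x n) - f i (x n) * f i (e i) = 0"
      proof (cases "e i = 0")
        case True
        then have "g (e i) y = 0" for y using g(3) by simp
        then have "f i (x n) = 0" by (subst f_rec) simp
        then show ?thesis by simp
      next
        case False
        then show ?thesis using Suc.IH i by simp
      qed
      finally show ?thesis .
    qed
    have right: "f n (e j) = 0" if j: "j < n" for j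
    proof -
      have "(\<Sum>i<n. g (e n) (e i) * f i (e j)) = (\<Sum>i<n. if i = j then g (e n) (e j) * f j (e j) else 0)"
        using Suc.IH j by (intro sum.cong) auto
      also have "\<dots> = g (e n) (e j) * f j (e j)" using j by simp
      also have "\<dots> = g (e n) (e j)"
        using Suc.IH j dual_space_zero[OF g(1)] by (cases "e j = 0") auto
      finally show ?thesis by (subst f_rec) simp
    qed
    have "f n (e n) = g (e n) (e n)"
      by (subst f_rec) (use left in simp)
    then have diag: "f n (e n) = (if e n \<noteq> 0 then 1 else 0)"
      using g by auto
    show ?case
      using Suc.IH left right diag by (auto simp: less_Suc_eq)
  qed simp
  from this[of "Suc (max i j)"] show "f i (e j) = (if i = j \<and> e j \<noteq> 0 then 1 else 0)"
    by (auto simp: less_Suc_eq_le)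
  show "f n \<in> dual_space" by (rule f)
  have "x n = e n + (\<Sum>i<n. smul (f i (x n)) (e i))" by (subst e_rec) simp
  also have "\<dots> \<in> span (e ` {..n})"
    by (intro span_add span_sum span_scale span_base) auto
  finally show "x n \<in> span (e ` {..n})" .
qed

end

text \<open>The projection onto the span of finitely many biorthogonal vectors is continuous and the
  identity on the span, hence also on its closure. In particular such a span is closed.\<close>

lemma finite_biorthogonal_reproduces_closure:
  assumes I: "finite I" and f: "\<And>i. i \<in> I \<Longrightarrow> f i \<in> dual_space"
    and biorth: "\<And>i j. i \<in> I \<Longrightarrow> j \<in> I \<Longrightarrow> f i (e j) = (if i = j then 1 else 0)"
    and y: "y \<in> closure (span (e ` I))"
  shows "y = (\<Sum>i\<in>I. smul (f i y) (e i))"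
proof -
  let ?P = "\<lambda>y. \<Sum>i\<in>I. smul (f i y) (e i)"
  have cont: "continuous_on UNIV ?P"
    by (intro continuous_on_sum bounded_bilinear.continuous_on[OF bounded_bilinear_smul]
        dual_space_continuous f continuous_on_const)
  have reproduces: "?P y = y" if "y \<in> span (e ` I)" for y
    using that
  proof (induction rule: span_induct_alt)
    case base
    have "?P 0 = (\<Sum>i\<in>I. 0)"
      by (intro sum.cong refl) (simp only: dual_space_zero[OF f] scale_zero_left)
    then show ?case by simp
  next
    case (step c v z)
    then obtain j where j: "j \<in> I" "v = e j" by blast
    have "?P (smul c v + z) = (\<Sum>i\<in>I. (if i = j then smul c (e j) else 0) + smul (f i z) (e i))"
    proof (intro sum.cong refl)
      fix i assume i: "i \<in> I"
      show "smul (f i (smul c v + z)) (e i) =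
          (if i = j then smul c (e j) else 0) + smul (f i z) (e i)"
        unfolding dual_space_add[OF f[OF i]] dual_space_smul[OF f[OF i]] j(2) biorth[OF i j(1)]
        by (simp add: scale_left_distrib)
    qed
    then show ?case using step.IH j I by (simp add: sum.distrib)
  qed
  have "?P y - y = 0"
  proof (rule continuous_constant_on_closure[where f = "\<lambda>y. ?P y - y", OF _ _ y])
    show "continuous_on (closure (span (e ` I))) (\<lambda>y. ?P y - y)"
      by (intro continuous_on_diff continuous_on_id continuous_on_subset[OF cont]) simp
  qed (simp add: reproduces)
  then show ?thesis by (simp only: eq_iff_diff_eq_0[symmetric])
qed

text \<open>The Gram-Schmidt recursion is applied to a dense sequence. Infinitely many of its vectors are
  nonzero, as otherwise their span would be both closed and dense.\<close>

theorem fundamental_biorthogonal_sequence: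
  assumes separable: "separable_space (euclidean :: 'a topology)"
    and infdim: "infinite_dimensional smul"
    and separates: "\<And>x. x \<noteq> 0 \<Longrightarrow> \<exists>f\<in>dual_space. f x \<noteq> 0"
  obtains e :: "nat \<Rightarrow> 'a" and f :: "nat \<Rightarrow> 'a \<Rightarrow> 'k"
  where "\<And>n. f n \<in> dual_space" "\<And>i j. f i (e j) = (if i = j then 1 else 0)"
    "closure (span (range e)) = UNIV"
proof -
  obtain D :: "'a set" where D: "countable D" "closure D = UNIV"
    using separable by (auto simp: separable_space_def)
  then have "D \<noteq> {}" by auto
  define x where "x = from_nat_into D"
  have range_x: "range x = D"
    using D \<open>D \<noteq> {}\<close> by (simp add: x_def range_from_nat_into)
  obtain g where g: "\<And>z. g z \<in> dual_space" "\<And>z. z \<noteq> 0 \<Longrightarrow> g z z = 1" "\<And>y. g 0 y = 0"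
    using dual_space_separates_normalized[OF separates] by blast
  define e f where "e n = fst (gram_schmidt x g n)" and "f n = snd (gram_schmidt x g n)" for n
  note gs = gram_schmidt_biorthogonal[where x = x, OF g, folded e_def f_def]
  define I where "I = {n. e n \<noteq> 0}"
  have range_I: "span (range e) = span (e ` I)"
  proof -
    have "range e \<subseteq> insert 0 (e ` I)" by (auto simp: I_def)
    then show ?thesis
      by (metis (no_types) image_mono span_insert_0 span_mono subset_UNIV subset_antisym)
  qed
  have "D \<subseteq> span (range e)"
    using gs(3) span_mono[of "e ` {.._}" "range e"] by (force simp: range_x[symmetric])
  then have dense: "closure (span (e ` I)) = UNIV"
    using closure_mono[of D "span (range e)"] D range_I by auto
  have "infinite I"
  proof
    assume "finite I"
    have "y \<in> span (e ` I)" for y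
    proof -
      have "y = (\<Sum>i\<in>I. smul (f i y) (e i))"
        by (rule finite_biorthogonal_reproduces_closure[OF \<open>finite I\<close>])
          (use gs dense in \<open>auto simp: I_def\<close>)
      also have "\<dots> \<in> span (e ` I)" by (intro span_sum span_scale span_base) auto
      finally show ?thesis .
    qed
    then have "finite (e ` I) \<and> span (e ` I) = UNIV" using \<open>finite I\<close> by auto
    then show False using infdim unfolding infinite_dimensional_def by blast
  qed
  define \<sigma> where "\<sigma> = enumerate I"
  have \<sigma>: "range \<sigma> = I" "inj \<sigma>"
    using \<open>infinite I\<close> by (auto simp: \<sigma>_def range_enumerate inj_enumerate)
  show ?thesis
  proof (rule that)
    show "f (\<sigma> n) \<in> dual_space" for n by (rule gs)
    have "e (\<sigma> j) \<noteq> 0" for j using \<sigma>(1) by (auto simp: I_def)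
    then show "f (\<sigma> i) (e (\<sigma> j)) = (if i = j then 1 else 0)" for i j
      using gs(2) \<sigma>(2) by (auto simp: inj_eq)
    have "range (\<lambda>n. e (\<sigma> n)) = e ` I" using \<sigma>(1) by auto
    then show "closure (span (range (\<lambda>n. e (\<sigma> n)))) = UNIV" using dense by simp
  qed
qed

end

section \<open>Rotations and escaping orbits\<close>

lemma abs_cos_minus_one_le:
  fixes t :: real
  shows "\<bar>cos t - 1\<bar> \<le> \<bar>t\<bar>"
proof -
  have "\<bar>cos t - 1\<bar> = 2 * (sin (t/2))\<^sup>2"
    using cos_double_sin[of "t/2"] by simp
  also have "\<dots> \<le> 2 * \<bar>sin (t/2)\<bar>"
    using mult_left_mono[OF abs_sin_le_one[of "t/2"], of "\<bar>sin (t/2)\<bar>"]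
    by (simp add: power2_eq_square flip: abs_mult)
  also have "\<dots> \<le> \<bar>t\<bar>"
    using abs_sin_x_le_abs_x[of "t/2"] by simp
  finally show ?thesis .
qed

text \<open>Both sums are parts of the geometric sum of the powers of \<open>cis t\<close>.\<close>

lemma sum_cos_sin_full_turns:
  fixes t :: real and n :: nat
  assumes "cos t \<noteq> 1" "cos (n * t) = 1" "sin (n * t) = 0"
  shows "(\<Sum>l<n. cos (l * t)) = 0" and "(\<Sum>l<n. sin (l * t)) = 0"
proof -
  have "cis t \<noteq> 1" using assms(1) by (auto simp: complex_eq_iff)
  have "(\<Sum>l<n. cis (l * t)) = (\<Sum>l<n. cis t ^ l)"
    by (intro sum.cong refl) (simp only: Complex.DeMoivre)
  also have "\<dots> = (cis t ^ n - 1) / (cis t - 1)"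
    by (rule geometric_sum) fact
  also have "cis t ^ n = 1"
    unfolding Complex.DeMoivre using assms(2,3) by (simp add: complex_eq_iff del: Complex.DeMoivre)
  finally have zero: "(\<Sum>l<n. cis (l * t)) = 0" by simp
  show "(\<Sum>l<n. cos (l * t)) = 0" using arg_cong[OF zero, of Re] by simp
  show "(\<Sum>l<n. sin (l * t)) = 0" using arg_cong[OF zero, of Im] by simp
qed

lemma sum_cos_ge_half:
  fixes t :: real and n :: nat
  assumes "0 \<le> t" "n * t \<le> pi / 3"
  shows "n / 2 \<le> (\<Sum>l<n. cos (l * t))"
proof -
  have "1/2 \<le> cos (l * t)" if "l < n" for l
  proof -
    have "l * t \<le> n * t" using that assms(1) by (intro mult_right_mono) auto
    then have "l * t \<le> pi / 3" using assms(2) by simp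
    then have "cos (pi/3) \<le> cos (l * t)"
      using assms(1) by (intro cos_monotone_0_pi_le) auto
    then show ?thesis by (simp add: cos_60)
  qed
  then have "(\<Sum>l<n. 1/2) \<le> (\<Sum>l<n. cos (l * t))" by (intro sum_mono) auto
  then show ?thesis by simp
qed

text \<open>Only finitely many points of an escaping orbit lie near \<open>x\<close>, so recurrence would force one of
  them to equal \<open>x\<close>; but then the orbit is periodic.\<close>

lemma not_Rec_if_orbit_escapes:
  fixes T :: "'a::real_normed_vector \<Rightarrow> 'a"
  assumes "filterlim (\<lambda>n. norm ((T ^^ n) x)) at_top sequentially"
  shows "x \<notin> Rec T"
proof
  assume "x \<in> Rec T"
  then have cl: "x \<in> closure {(T ^^ n) x |n. n \<ge> 1}" by (simp add: Rec_def)
  obtain m where m: "\<And>n. n \<ge> m \<Longrightarrow> norm ((T ^^ n) x) \<ge> norm x + 1"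
    using assms by (auto simp: filterlim_at_top eventually_sequentially)
  define F where "F = (\<lambda>n. (T ^^ n) x) ` {1..m}"
  define G where "G = {(T ^^ n) x |n. n \<ge> m}"
  have "{(T ^^ n) x |n. n \<ge> 1} \<subseteq> F \<union> G"
  proof
    fix y assume "y \<in> {(T ^^ n) x |n. n \<ge> 1}"
    then obtain n where "n \<ge> 1" "y = (T ^^ n) x" by blast
    then show "y \<in> F \<union> G" by (cases "n \<le> m") (auto simp: F_def G_def)
  qed
  then have "x \<in> closure F \<union> closure G"
    using cl closure_mono[of _ "F \<union> G"] by (auto simp: closure_Un)
  moreover have "closure F = F" by (simp add: F_def finite_imp_closed)
  moreover have "closure G \<subseteq> {y. norm y \<ge> norm x + 1}"
    by (rule closure_minimal) (auto simp: G_def m intro!: closed_Collect_le continuous_intros)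
  ultimately obtain n where n: "n \<ge> 1" "(T ^^ n) x = x" by (force simp: F_def)
  have "(T ^^ (j * n)) x = x" for j
  proof (induction j)
    case (Suc j)
    have "(T ^^ (Suc j * n)) x = (T ^^ n) ((T ^^ (j * n)) x)" by (simp add: funpow_add)
    then show ?case using Suc n by simp
  qed simp
  from this[of m] m[of "m * n"] n show False by simp
qed

section \<open>The operator\<close>

text \<open>The quotient of the coordinates of a vector with respect to \<open>e 0\<close> and \<open>e 1\<close> is called its slope.
  The sequence \<open>q\<close> lists slopes for which all finite combinations will be recurrent; vectors of
  slope \<open>\<alpha>\<close> will escape to infinity.\<close>

locale rotation_shear = banach_space_over smul
  for smul :: "'k::real_normed_field \<Rightarrow> 'a::banach \<Rightarrow> 'a" +
  fixes e :: "nat \<Rightarrow> 'a" and f :: "nat \<Rightarrow> 'a \<Rightarrow> 'k" and q :: "nat \<Rightarrow> 'k" and \<alpha> :: 'k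
  assumes f: "\<And>n. f n \<in> dual_space"
    and biorth: "\<And>i j. f i (e j) = (if i = j then 1 else 0)"
    and dense_span: "closure (span (range e)) = UNIV"
    and dense_q: "closure (range q) = UNIV"
    and repeats: "\<And>k. infinite {j. q j = q k}"
    and avoids: "\<And>k. \<alpha> \<noteq> q k"
begin

definition p1 where "p1 = e 0"
definition p2 where "p2 = e 1"
definition a where "a k = e (2 * k + 2)"
definition b where "b k = e (2 * k + 3)"
definition \<phi> where "\<phi> = f 0"
definition \<psi> where "\<psi> = f 1"
definition A where "A k = f (2 * k + 2)"
definition B where "B k = f (2 * k + 3)"

text \<open>On the \<open>k\<close>-th plane, spanned by \<open>a k\<close> and \<open>b k\<close>, the operator will rotate by the angle
  \<open>\<theta> k = 2 * pi / M (Suc k)\<close> and add \<open>c k * g k x\<close> times \<open>a k\<close>, where \<open>c k = w k / M k\<close>. The functional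
  \<open>g k\<close> depends on the first two coordinates only and vanishes on the line of slope \<open>q k\<close>.
  The two requirements on the constants pull in opposite directions. At times comparable to
  \<open>M k\<close> the added terms have accumulated to about \<open>w k * g k x\<close>, and \<open>w k\<close> is so large that for
  vectors of slope \<open>\<alpha>\<close> the norm of this is \<open>k * K k * norm (\<psi> x)\<close>, while \<open>K k\<close> bounds the
  functionals that detect it. Once \<open>w\<close> is fixed, the periods \<open>M\<close> grow so fast that everything happening on the
  planes after the \<open>k\<close>-th one is still negligible at time \<open>M k\<close>; the two summands in \<open>N\<close>
  control the rotations and the added terms.\<close>

definition g where "g k x = \<phi> x - q k * \<psi> x"
definition K where "K k = 1 + onorm (A k) + onorm (B k)"
definition L where "L k = norm (a k) + norm (b k)"
definition w where "w k = real k * K k / norm (\<alpha> - q k)"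
definition W where "W k = w k * (1 + norm (q k)) * L k"
definition N where "N k = nat \<lceil>2 ^ k * (K k * L k) + 2 ^ Suc k * W (Suc k)\<rceil> + 2"
definition M where "M k = (\<Prod>i<k. N i)"
definition \<theta> where "\<theta> k = 2 * pi / real (M (Suc k))"
definition c where "c k = w k / real (M k)"

text \<open>The coefficients of \<open>T x - x\<close> with respect to \<open>a k\<close> and \<open>b k\<close>.\<close>

definition u where
  "u k x = of_real (cos (\<theta> k) - 1) * A k x - of_real (sin (\<theta> k)) * B k x + of_real (c k) * g k x"
definition v where
  "v k x = of_real (sin (\<theta> k)) * A k x + of_real (cos (\<theta> k) - 1) * B k x"
definition D where "D k x = smul (u k x) (a k) + smul (v k x) (b k)"
definition T where "T x = x + (\<Sum>k. D k x)"

lemma coordinate_dual: "\<phi> \<in> dual_space" "\<psi> \<in> dual_space" "A k \<in> dual_space" "B k \<in> dual_space"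
  by (simp_all only: \<phi>_def \<psi>_def A_def B_def f)

lemma coordinate_values:
  "\<phi> p1 = 1" "\<phi> p2 = 0" "\<phi> (a j) = 0" "\<phi> (b j) = 0"
  "\<psi> p1 = 0" "\<psi> p2 = 1" "\<psi> (a j) = 0" "\<psi> (b j) = 0"
  "A k (a j) = (if j = k then 1 else 0)" "A k (b j) = 0"
  "B k (a j) = 0" "B k (b j) = (if j = k then 1 else 0)"
  unfolding \<phi>_def \<psi>_def A_def B_def p1_def p2_def a_def b_def biorth by (auto, presburger+)

lemmas coordinate_add = coordinate_dual[THEN dual_space_add]
  and coordinate_smul = coordinate_dual[THEN dual_space_smul]
  and coordinate_bounded_linear = coordinate_dual[THEN dual_space_bounded_linear]

lemma K_ge_1: "K k \<ge> 1" and K_bound: "norm (A k x) + norm (B k x) \<le> K k * norm x"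
proof -
  show "K k \<ge> 1" using coordinate_bounded_linear[THEN onorm_pos_le] by (simp add: K_def)
  have "norm (A k x) + norm (B k x) \<le> onorm (A k) * norm x + onorm (B k) * norm x"
    by (intro add_mono onorm coordinate_bounded_linear)
  also have "\<dots> \<le> K k * norm x" by (simp add: K_def algebra_simps)
  finally show "norm (A k x) + norm (B k x) \<le> K k * norm x" .
qed

lemma L_nonneg: "L k \<ge> 0" by (simp add: L_def)
lemma w_nonneg: "w k \<ge> 0" using K_ge_1[of k] by (simp add: w_def)
lemma W_nonneg: "W k \<ge> 0" using w_nonneg L_nonneg by (simp add: W_def)

lemma N_ge: "real (N k) \<ge> 2 ^ k * (K k * L k)" "real (N k) \<ge> 2 ^ Suc k * W (Suc k)" "N k \<ge> 2"
proof -
  have "2 ^ k * (K k * L k) \<ge> 0" "2 ^ Suc k * W (Suc k) \<ge> 0"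
    using K_ge_1[of k] L_nonneg W_nonneg by (auto intro!: mult_nonneg_nonneg)
  moreover have "real (N k) \<ge> 2 ^ k * (K k * L k) + 2 ^ Suc k * W (Suc k)"
    unfolding N_def by linarith
  ultimately show "real (N k) \<ge> 2 ^ k * (K k * L k)" "real (N k) \<ge> 2 ^ Suc k * W (Suc k)"
    by linarith+
  show "N k \<ge> 2" by (simp add: N_def)
qed

lemma M_0: "M 0 = 1" and M_Suc: "M (Suc k) = M k * N k"
  by (simp_all add: M_def)

lemma M_pos: "M k > 0"
  using N_ge(3) by (auto simp: M_def intro!: prod_pos) (metis less_le_trans pos2)

lemma M_dvd: "i \<le> k \<Longrightarrow> M i dvd M k"
  unfolding M_def by (intro prod_dvd_prod_subset) auto

lemma M_mono: "i \<le> k \<Longrightarrow> M i \<le> M k"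
  using M_dvd M_pos by (simp add: dvd_imp_le)

lemma M_Suc_ge: "M (Suc k) \<ge> 2 * M k"
  using N_ge(3)[of k] by (simp add: M_Suc)

lemma M_unbounded: "M k > k"
proof (induction k)
  case (Suc k)
  then show ?case using M_Suc_ge[of k] by simp
qed (simp add: M_0)

text \<open>On the plane with \<open>k = 0\<close> nothing is added, since \<open>w 0 = 0\<close>; for \<open>k > 0\<close> the factor \<open>N (k - 1)\<close>
  of \<open>M k\<close> outweighs \<open>W k\<close>.\<close>

lemma W_bound:
  assumes "k > 0 \<Longrightarrow> i < k"
  shows "real (M i) * (c k * (1 + norm (q k)) * L k) \<le> (1/2) ^ k"
proof (cases k)
  case 0
  then show ?thesis by (simp add: c_def w_def)
next
  case (Suc j)
  have "real (M i) \<le> M j" using assms Suc M_mono by simp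
  have "real (M i) * (c k * (1 + norm (q k)) * L k) = real (M i) * W k / M k"
    by (simp add: c_def W_def)
  also have "\<dots> \<le> real (M j) * W k / M k"
    using \<open>real (M i) \<le> M j\<close> W_nonneg by (intro divide_right_mono mult_right_mono) auto
  also have "\<dots> = W k / N j"
    using M_pos[of j] by (simp add: Suc M_Suc)
  also have "\<dots> \<le> (1/2) ^ k"
    using N_ge(2,3)[of j] by (simp add: Suc field_simps)
  finally show ?thesis .
qed

lemma rotation_bound: "\<theta> k * (K k * L k) \<le> 2 * pi * (1/2) ^ k" and \<theta>_pos: "\<theta> k > 0"
proof -
  show "\<theta> k > 0" using M_pos by (simp add: \<theta>_def)
  have "2 ^ k * (K k * L k) \<le> real (N k)" by (rule N_ge)
  also have "\<dots> \<le> real (M (Suc k))" using M_pos[of k] mult_right_mono[of 1 "real (M k)" "real (N k)"] by (simp add: M_Suc)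
  finally have "K k * L k \<le> real (M (Suc k)) * (1/2) ^ k" by (simp add: field_simps)
  then have "\<theta> k * (K k * L k) \<le> \<theta> k * (real (M (Suc k)) * (1/2) ^ k)"
    using \<open>\<theta> k > 0\<close> by (intro mult_left_mono) auto
  also have "\<dots> = 2 * pi * (1/2) ^ k"
    using M_pos[of "Suc k"] by (simp add: \<theta>_def)
  finally show "\<theta> k * (K k * L k) \<le> 2 * pi * (1/2) ^ k" .
qed

lemma c_nonneg: "c k \<ge> 0" using w_nonneg by (simp add: c_def)

lemma g_bound: "norm (g k x) \<le> (1 + norm (q k)) * (norm (\<phi> x) + norm (\<psi> x))"
proof -
  have "norm (g k x) \<le> norm (\<phi> x) + norm (q k) * norm (\<psi> x)"
    unfolding g_def by (metis norm_mult norm_triangle_ineq4)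
  also have "\<dots> \<le> (1 + norm (q k)) * (norm (\<phi> x) + norm (\<psi> x))"
    by (simp add: algebra_simps)
  finally show ?thesis .
qed

text \<open>With \<open>i = 0\<close> this makes the series defining the operator converge; with \<open>i < k\<close> arbitrary it says
  that up to time \<open>M i\<close> the terms added on the later planes stay small.\<close>

lemma coupling_bound:
  assumes "k > 0 \<Longrightarrow> i < k"
  shows "real (M i) * (c k * norm (g k x) * L k) \<le> (1/2) ^ k * (norm (\<phi> x) + norm (\<psi> x))"
proof -
  have "real (M i) * (c k * norm (g k x) * L k)
      \<le> real (M i) * (c k * ((1 + norm (q k)) * (norm (\<phi> x) + norm (\<psi> x))) * L k)"
    using c_nonneg L_nonneg g_bound by (intro mult_left_mono mult_right_mono) auto
  also have "\<dots> = real (M i) * (c k * (1 + norm (q k)) * L k) * (norm (\<phi> x) + norm (\<psi> x))"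
    by simp
  also have "\<dots> \<le> (1/2) ^ k * (norm (\<phi> x) + norm (\<psi> x))"
    using W_bound[OF assms] by (intro mult_right_mono) auto
  finally show ?thesis .
qed

lemma norm_smul_pair_le:
  assumes "norm s \<le> r" "norm t \<le> r"
  shows "norm (smul s (a k) + smul t (b k)) \<le> r * L k"
proof -
  have "norm (smul s (a k) + smul t (b k)) \<le> norm s * norm (a k) + norm t * norm (b k)"
    by (metis norm_smul norm_triangle_ineq)
  also have "\<dots> \<le> r * norm (a k) + r * norm (b k)"
    using assms by (intro add_mono mult_right_mono) auto
  finally show ?thesis by (simp add: L_def algebra_simps)
qed

definition bound where "bound = 2 * pi + onorm \<phi> + onorm \<psi>"

lemma D_bound: "norm (D k x) \<le> (1/2) ^ k * (bound * norm x)"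
proof -
  let ?s = "of_real (cos (\<theta> k) - 1) * A k x - of_real (sin (\<theta> k)) * B k x"
  let ?t = "of_real (sin (\<theta> k)) * A k x + of_real (cos (\<theta> k) - 1) * B k x"
  have cs: "\<bar>cos (\<theta> k) - 1\<bar> \<le> \<theta> k" "\<bar>sin (\<theta> k)\<bar> \<le> \<theta> k"
    using abs_cos_minus_one_le[of "\<theta> k"] abs_sin_x_le_abs_x[of "\<theta> k"] \<theta>_pos[of k] by auto
  have "norm (of_real r * u + of_real s * v) \<le> \<theta> k * (norm u + norm v)"
    if "\<bar>r\<bar> \<le> \<theta> k" "\<bar>s\<bar> \<le> \<theta> k" for r s and u v :: 'k
  proof -
    have "norm (of_real r * u + of_real s * v) \<le> \<bar>r\<bar> * norm u + \<bar>s\<bar> * norm v"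
      using norm_triangle_ineq[of "of_real r * u" "of_real s * v"] by (simp add: norm_mult)
    also have "\<dots> \<le> \<theta> k * norm u + \<theta> k * norm v"
      using that by (intro add_mono mult_right_mono) auto
    finally show ?thesis by (simp add: algebra_simps)
  qed
  note comb = this
  have AB: "\<theta> k * (norm (A k x) + norm (B k x)) \<le> \<theta> k * (K k * norm x)"
    using \<theta>_pos[of k] K_bound by (intro mult_left_mono) auto
  have s: "norm ?s \<le> \<theta> k * (K k * norm x)"
    using comb[of "cos (\<theta> k) - 1" "- sin (\<theta> k)" "A k x" "B k x"] cs AB by simp
  have t: "norm ?t \<le> \<theta> k * (K k * norm x)"
    using comb[of "sin (\<theta> k)" "cos (\<theta> k) - 1" "A k x" "B k x"] cs AB by simp
  have split: "D k x = (smul ?s (a k) + smul ?t (b k)) + smul (of_real (c k) * g k x) (a k)"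
    by (simp add: D_def u_def v_def scale_left_distrib)
  have "norm (D k x) \<le> \<theta> k * (K k * norm x) * L k + c k * norm (g k x) * L k"
    unfolding split
  proof (intro norm_triangle_mono norm_smul_pair_le s t)
    have "c k * norm (g k x) * norm (a k) \<le> c k * norm (g k x) * L k"
      using c_nonneg by (intro mult_left_mono) (auto simp: L_def)
    then show "norm (smul (of_real (c k) * g k x) (a k)) \<le> c k * norm (g k x) * L k"
      using c_nonneg by (simp add: norm_smul norm_mult)
  qed
  also have "\<dots> \<le> 2 * pi * (1/2) ^ k * norm x
      + (1/2) ^ k * (onorm \<phi> * norm x + onorm \<psi> * norm x)"
  proof (intro add_mono)
    have "\<theta> k * (K k * norm x) * L k = \<theta> k * (K k * L k) * norm x" by simp
    also have "\<dots> \<le> 2 * pi * (1/2) ^ k * norm x"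
      by (rule mult_right_mono[OF rotation_bound]) simp
    finally show "\<theta> k * (K k * norm x) * L k \<le> 2 * pi * (1/2) ^ k * norm x" .
    have "c k * norm (g k x) * L k \<le> (1/2) ^ k * (norm (\<phi> x) + norm (\<psi> x))"
      using coupling_bound[where i = 0] by (simp add: M_0)
    also have "\<dots> \<le> (1/2) ^ k * (onorm \<phi> * norm x + onorm \<psi> * norm x)"
      by (intro mult_left_mono add_mono onorm coordinate_bounded_linear) auto
    finally show "c k * norm (g k x) * L k
      \<le> (1/2) ^ k * (onorm \<phi> * norm x + onorm \<psi> * norm x)" .
  qed
  finally show ?thesis by (simp add: bound_def algebra_simps)
qed

lemma g_add: "g k (x + y) = g k x + g k y" and g_smul: "g k (smul s x) = s * g k x"
  by (simp_all add: g_def coordinate_add coordinate_smul algebra_simps)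

lemma u_add: "u k (x + y) = u k x + u k y" and u_smul: "u k (smul s x) = s * u k x"
  and v_add: "v k (x + y) = v k x + v k y" and v_smul: "v k (smul s x) = s * v k x"
  by (simp_all add: u_def v_def coordinate_add coordinate_smul g_add g_smul algebra_simps)

lemma D_add: "D k (x + y) = D k x + D k y" and D_smul: "D k (smul s x) = smul s (D k x)"
  by (simp_all add: D_def u_add u_smul v_add v_smul scale_left_distrib scale_right_distrib ac_simps)

lemma summable_geometric_bound: "summable (\<lambda>k. (1/2) ^ k * (r :: real))"
  by (intro summable_mult2 summable_geometric) simp

lemma D_summable: "summable (\<lambda>k. D k x)"
  by (rule summable_comparison_test'[OF summable_geometric_bound D_bound])

lemma T_sums: "(\<lambda>k. D k x) sums (T x - x)"
  using summable_sums[OF D_summable] by (simp add: T_def)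

lemma T_add: "T (x + y) = T x + T y"
  by (simp add: T_def D_add suminf_add[symmetric] D_summable)

lemma T_smul: "T (smul s x) = smul s (T x)"
  using bounded_linear.suminf[OF bounded_bilinear.bounded_linear_right[OF bounded_bilinear_smul] D_summable]
  by (simp add: T_def D_smul scale_right_distrib)

lemma T_bounded_linear: "bounded_linear T"
proof (rule bounded_linear_intro)
  show "T (x + y) = T x + T y" for x y by (rule T_add)
  show "T (r *\<^sub>R x) = r *\<^sub>R T x" for r x
    using T_smul[of "of_real r" x] by (simp add: smul_of_real)
  show "norm (T x) \<le> norm x * (1 + 2 * bound)" for x
  proof -
    have "norm (T x - x) \<le> 2 * (bound * norm x)"
      using norm_sums_le[OF T_sums sums_mult2[OF geometric_sums] D_bound, of x] by simp
    then show ?thesis using norm_triangle_ineq2[of "T x" x] by (simp add: algebra_simps)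
  qed
qed

lemma T_bounded_operator: "bounded_operator smul T"
  unfolding bounded_operator_def
proof
  show "Vector_Spaces.linear smul smul T"
    by unfold_locales (auto simp: T_add T_smul)
  show "continuous_on UNIV T"
    by (rule bounded_linear.continuous_on[OF T_bounded_linear continuous_on_id])
qed

lemma functional_T_sums:
  assumes "F \<in> dual_space"
  shows "(\<lambda>k. u k x * F (a k) + v k x * F (b k)) sums (F (T x) - F x)"
  using bounded_linear.sums[OF dual_space_bounded_linear[OF assms] T_sums, of x]
  by (simp only: D_def dual_space_diff[OF assms] dual_space_add[OF assms] dual_space_smul[OF assms])

lemma \<phi>_T: "\<phi> (T x) = \<phi> x" and \<psi>_T: "\<psi> (T x) = \<psi> x"
proof -
  have "F (T x) = F x" if F: "F \<in> dual_space" and 0: "\<And>k. F (a k) = 0" "\<And>k. F (b k) = 0" for F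
    using functional_T_sums[OF F, of x] sums_unique2[OF sums_zero] by (fastforce simp: 0)
  then show "\<phi> (T x) = \<phi> x" "\<psi> (T x) = \<psi> x"
    using coordinate_dual coordinate_values by blast+
qed

lemma g_T: "g k (T x) = g k x"
  by (simp only: g_def \<phi>_T \<psi>_T)

lemma A_T: "A k (T x) = of_real (cos (\<theta> k)) * A k x - of_real (sin (\<theta> k)) * B k x + of_real (c k) * g k x"
  and B_T: "B k (T x) = of_real (sin (\<theta> k)) * A k x + of_real (cos (\<theta> k)) * B k x"
proof -
  have "u j x * A k (a j) + v j x * A k (b j) = (if j = k then u j x else 0)"
    "u j x * B k (a j) + v j x * B k (b j) = (if j = k then v j x else 0)" for j
    by (simp_all add: coordinate_values)
  then have sums: "(\<lambda>j. if j = k then u j x else 0) sums (A k (T x) - A k x)"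
    "(\<lambda>j. if j = k then v j x else 0) sums (B k (T x) - B k x)"
    using functional_T_sums[OF coordinate_dual(3), of x k]
      functional_T_sums[OF coordinate_dual(4), of x k] by simp_all
  have "A k (T x) - A k x = u k x" by (rule sums_unique2[OF sums(1) sums_single])
  moreover have "B k (T x) - B k x = v k x" by (rule sums_unique2[OF sums(2) sums_single])
  ultimately show "A k (T x) = of_real (cos (\<theta> k)) * A k x - of_real (sin (\<theta> k)) * B k x + of_real (c k) * g k x"
    "B k (T x) = of_real (sin (\<theta> k)) * A k x + of_real (cos (\<theta> k)) * B k x"
    by (simp_all add: u_def v_def algebra_simps)
qed

lemma g_iterate: "g k ((T ^^ n) x) = g k x"
  by (induction n) (simp_all add: g_T)

text \<open>In each plane the orbit is the rotated initial position plus the constant vector \<open>c k * g k x\<close>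
  in direction \<open>a k\<close>, summed over its rotations; \<open>g k\<close> is invariant under the operator.\<close>

lemma AB_iterate:
  "A k ((T ^^ n) x) = of_real (cos (real n * \<theta> k)) * A k x - of_real (sin (real n * \<theta> k)) * B k x
     + of_real (c k * (\<Sum>l<n. cos (real l * \<theta> k))) * g k x \<and>
   B k ((T ^^ n) x) = of_real (sin (real n * \<theta> k)) * A k x + of_real (cos (real n * \<theta> k)) * B k x
     + of_real (c k * (\<Sum>l<n. sin (real l * \<theta> k))) * g k x"
proof (induction n)
  case (Suc n)
  have arg: "real (Suc n) * \<theta> k = \<theta> k + real n * \<theta> k" by (simp add: algebra_simps)
  have cos_sum: "(\<Sum>l<Suc n. cos (real l * \<theta> k))
      = 1 + (cos (\<theta> k) * (\<Sum>l<n. cos (real l * \<theta> k)) - sin (\<theta> k) * (\<Sum>l<n. sin (real l * \<theta> k)))"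
    unfolding sum.lessThan_Suc_shift
    by (simp add: distrib_right cos_add sum_subtractf sum_distrib_left)
  have sin_sum: "(\<Sum>l<Suc n. sin (real l * \<theta> k))
      = sin (\<theta> k) * (\<Sum>l<n. cos (real l * \<theta> k)) + cos (\<theta> k) * (\<Sum>l<n. sin (real l * \<theta> k))"
    unfolding sum.lessThan_Suc_shift
    by (simp add: distrib_right sin_add sum.distrib sum_distrib_left)
  show ?case
    unfolding arg cos_sum sin_sum cos_add sin_add funpow.simps comp_apply A_T B_T g_iterate
      Suc.IH[THEN conjunct1] Suc.IH[THEN conjunct2]
    by (simp add: algebra_simps)
qed simp

lemmas A_iterate = AB_iterate[THEN conjunct1] and B_iterate = AB_iterate[THEN conjunct2]

section \<open>Recurrent vectors\<close>

definition displacement where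
  "displacement n x k = smul (A k ((T ^^ n) x) - A k x) (a k) + smul (B k ((T ^^ n) x) - B k x) (b k)"

text \<open>The coordinates need not determine a vector, but the defining series telescopes along the orbit
  and so expresses the displacement by the coordinates of the iterates.\<close>

lemma displacement_sums: "displacement n x sums ((T ^^ n) x - x)"
proof (induction n)
  case 0
  then show ?case by (simp add: displacement_def[abs_def])
next
  case (Suc n)
  have "displacement (Suc n) x k = displacement n x k + D k ((T ^^ n) x)" for k
  proof -
    let ?y = "(T ^^ n) x"
    have "u k ?y = A k (T ?y) - A k ?y" "v k ?y = B k (T ?y) - B k ?y"
      by (simp_all add: u_def v_def A_T B_T algebra_simps)
    then show ?thesis
      by (simp add: displacement_def D_def scale_left_diff_distrib)
  qed
  then show ?case
    using sums_add[OF Suc T_sums[of "(T ^^ n) x"]] by (simp add: fun_eq_iff[symmetric])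
qed

lemma full_turns:
  assumes "M (Suc k) dvd n"
  shows "cos (real n * \<theta> k) = 1" "sin (real n * \<theta> k) = 0"
    "(\<Sum>l<n. cos (real l * \<theta> k)) = 0" "(\<Sum>l<n. sin (real l * \<theta> k)) = 0"
proof -
  obtain j where j: "n = M (Suc k) * j" using assms by blast
  have turn: "real n * \<theta> k = 2 * pi * j" using M_pos[of "Suc k"] by (simp add: \<theta>_def j)
  show cs: "cos (real n * \<theta> k) = 1" "sin (real n * \<theta> k) = 0"
    unfolding turn using cos_int_2pin[of "int j"] sin_int_2pin[of "int j"] by simp_all
  have "M (Suc k) \<ge> 2" using M_Suc_ge[of k] M_pos[of k] by simp
  then have "\<theta> k \<le> pi" by (simp add: \<theta>_def field_simps)
  then have "cos (\<theta> k) < cos 0" using \<theta>_pos[of k] by (intro cos_monotone_0_pi) auto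
  then have "cos (\<theta> k) \<noteq> 1" by simp
  from sum_cos_sin_full_turns[OF this cs]
  show "(\<Sum>l<n. cos (real l * \<theta> k)) = 0" "(\<Sum>l<n. sin (real l * \<theta> k)) = 0" by auto
qed

text \<open>At time \<open>M k\<close> the planes before the \<open>k\<close>-th one have made full turns, over which the added terms
  cancel. On the \<open>k\<close>-th plane nothing is added because \<open>g k x = 0\<close>. On the later planes
  little has been added so far.\<close>

lemma return_estimate:
  assumes fin: "\<And>j. j \<ge> k \<Longrightarrow> A j x = 0 \<and> B j x = 0" and g0: "g k x = 0"
  shows "norm ((T ^^ M k) x - x) \<le> (1/2) ^ k * (norm (\<phi> x) + norm (\<psi> x))"
proof -
  let ?n = "M k" and ?C = "norm (\<phi> x) + norm (\<psi> x)"
  have zero: "displacement ?n x j = 0" if "j < Suc k" for j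
  proof (cases "j = k")
    case True
    then show ?thesis using fin[of k] g0 by (simp add: displacement_def A_iterate B_iterate)
  next
    case False
    then have "M (Suc j) dvd ?n" using that by (intro M_dvd) auto
    from full_turns[OF this] show ?thesis by (simp add: displacement_def A_iterate B_iterate)
  qed
  have small: "norm (displacement ?n x j) \<le> (1/2) ^ j * ?C" if "j > k" for j
  proof -
    have sums: "\<bar>\<Sum>l<?n. cos (real l * \<theta> j)\<bar> \<le> ?n" "\<bar>\<Sum>l<?n. sin (real l * \<theta> j)\<bar> \<le> ?n"
      using sum_norm_le[of "{..<?n}" "\<lambda>l. cos (real l * \<theta> j)" "\<lambda>_. 1"]
        sum_norm_le[of "{..<?n}" "\<lambda>l. sin (real l * \<theta> j)" "\<lambda>_. 1"] by auto
    have "norm (displacement ?n x j) \<le> (c j * ?n * norm (g j x)) * L j"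
      unfolding displacement_def
      by (rule norm_smul_pair_le)
        (use fin[of j] that sums c_nonneg[of j] in
          \<open>auto simp: A_iterate B_iterate norm_mult abs_mult simp del: of_real_mult of_real_sum
            intro!: mult_right_mono mult_left_mono\<close>)
    also have "\<dots> = ?n * (c j * norm (g j x) * L j)" by simp
    also have "\<dots> \<le> (1/2) ^ j * ?C" using that by (intro coupling_bound) auto
    finally show ?thesis .
  qed
  have "(\<lambda>j. displacement ?n x (j + Suc k)) sums ((T ^^ ?n) x - x)"
    using displacement_sums zero by (subst sums_zero_iff_shift) auto
  moreover have "(\<lambda>j. (1/2) ^ j * ((1/2) ^ Suc k * ?C)) sums (1 / (1 - 1/2) * ((1/2) ^ Suc k * ?C))"
    by (intro sums_mult2 geometric_sums) simp
  moreover have "norm (displacement ?n x (j + Suc k)) \<le> (1/2) ^ j * ((1/2) ^ Suc k * ?C)" for j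
    using small[of "j + Suc k"] by (simp add: power_add mult_ac)
  ultimately have "norm ((T ^^ ?n) x - x) \<le> 1 / (1 - 1/2) * ((1/2) ^ Suc k * ?C)"
    by (rule norm_sums_le)
  then show ?thesis by simp
qed

lemma finite_support:
  assumes "x \<in> span (range e)"
  obtains J where "\<And>n. n \<ge> J \<Longrightarrow> f n x = 0"
proof -
  have "\<exists>J. \<forall>n\<ge>J. f n x = 0" using assms
  proof (induction rule: span_induct_alt)
    case base
    show ?case by (simp add: dual_space_zero[OF f])
  next
    case (step s z y)
    then obtain i J where "z = e i" "\<forall>n\<ge>J. f n y = 0" by blast
    then have "\<forall>n\<ge>max J (Suc i). f n (smul s z + y) = 0"
      by (simp add: dual_space_add[OF f] dual_space_smul[OF f] biorth)
    then show ?case by blast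
  qed
  then show ?thesis using that by blast
qed

text \<open>Since the slope \<open>q i\<close> is listed infinitely often, there are infinitely many return times \<open>M k\<close>.\<close>

lemma recurrent_point:
  assumes x: "x \<in> span (range e)" and ratio: "\<phi> x = q i * \<psi> x"
  shows "x \<in> Rec T"
  unfolding Rec_def mem_Collect_eq closure_approachable
proof (intro allI impI)
  fix \<epsilon> :: real assume "\<epsilon> > 0"
  let ?C = "norm (\<phi> x) + norm (\<psi> x)"
  obtain J where J: "\<And>n. n \<ge> J \<Longrightarrow> f n x = 0" using finite_support[OF x] by blast
  have "(\<lambda>k. (1/2) ^ k * ?C) \<longlonglongrightarrow> 0 * ?C"
    by (intro tendsto_mult tendsto_const LIMSEQ_power_zero) auto
  then have "\<forall>\<^sub>F k in sequentially. (1/2) ^ k * ?C < \<epsilon>"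
    using \<open>\<epsilon> > 0\<close> by (intro order_tendstoD(2)[where y = "0 * ?C"]) auto
  then obtain k0 where k0: "\<And>k. k \<ge> k0 \<Longrightarrow> (1/2) ^ k * ?C < \<epsilon>"
    by (auto simp: eventually_sequentially)
  obtain k where k: "k \<ge> max J k0" "q k = q i"
  proof -
    have "\<exists>k\<ge>max J k0. q k = q i"
      using repeats[of i] unfolding infinite_nat_iff_unbounded_le by blast
    then show ?thesis using that by blast
  qed
  have "norm ((T ^^ M k) x - x) \<le> (1/2) ^ k * ?C"
    using k J ratio by (intro return_estimate) (auto simp: g_def A_def B_def)
  also have "\<dots> < \<epsilon>" using k0 k(1) by simp
  finally have "dist ((T ^^ M k) x) x < \<epsilon>" by (simp add: dist_norm)
  moreover have "M k \<ge> 1" using M_pos[of k] by simp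
  ultimately show "\<exists>y\<in>{(T ^^ n) x |n. n \<ge> 1}. dist y x < \<epsilon>" by blast
qed

text \<open>A finite combination becomes recurrent after a small change of its first two coordinates, which
  moves its slope into the dense set of listed slopes.\<close>

lemma dense_recurrent_points: "closure (Rec T) = UNIV"
proof -
  have "z \<in> closure (Rec T)" if z: "z \<in> span (range e)" for z
    unfolding closure_approachable
  proof (intro allI impI)
    fix \<epsilon> :: real assume "\<epsilon> > 0"
    \<comment> \<open>The second coordinate is made nonzero first, so that the slope is defined.\<close>
    obtain t where t: "t \<noteq> 0" "norm (t - \<psi> z) * norm p2 < \<epsilon> / 2"
    proof (cases "\<psi> z = 0")
      case True
      define h r where "h = 1 + norm p2" and "r = \<epsilon> / (4 * h)"
      have "h > 0" by (simp add: h_def add_pos_nonneg)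
      then have "r > 0" using \<open>\<epsilon> > 0\<close> by (simp add: r_def)
      then have "r * norm p2 \<le> r * h" by (simp add: h_def)
      moreover have "r * h = \<epsilon> / 4" using \<open>h > 0\<close> by (simp add: r_def)
      ultimately show ?thesis
        using \<open>r > 0\<close> True \<open>\<epsilon> > 0\<close> by (intro that[of "of_real r"]) auto
    qed (use \<open>\<epsilon> > 0\<close> in \<open>auto intro: that\<close>)
    define h \<delta> where "h = 1 + norm p1" and "\<delta> = \<epsilon> / (2 * norm t * h)"
    have h: "h > 0" "norm p1 \<le> h" by (simp_all add: h_def add_pos_nonneg)
    then have "\<delta> > 0" using \<open>\<epsilon> > 0\<close> t by (simp add: \<delta>_def)
    then obtain i where i: "dist (q i) (\<phi> z / t) < \<delta>"
      using dense_q by (metis (no_types, lifting) UNIV_I closure_approachable imageE)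
    define y where "y = z + (smul (q i * t - \<phi> z) p1 + smul (t - \<psi> z) p2)"
    have "y \<in> span (range e)"
      unfolding y_def by (intro span_add span_scale span_base z) (auto simp: p1_def p2_def)
    moreover have "\<phi> y = q i * \<psi> y"
      unfolding y_def coordinate_add coordinate_smul coordinate_values by simp
    ultimately have "y \<in> Rec T" by (rule recurrent_point)
    moreover have "dist y z < \<epsilon>"
    proof -
      have "q i * t - \<phi> z = (q i - \<phi> z / t) * t" using t by (simp add: field_simps)
      then have "norm (q i * t - \<phi> z) = norm (q i - \<phi> z / t) * norm t" by (simp add: norm_mult)
      also have "\<dots> \<le> \<delta> * norm t" using i t by (intro mult_right_mono) (auto simp: dist_norm)
      finally have "norm (q i * t - \<phi> z) * norm p1 \<le> \<delta> * norm t * h"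
        using \<open>\<delta> > 0\<close> h by (intro mult_mono) auto
      also have "\<dots> = \<epsilon> / 2" using t h by (simp add: \<delta>_def)
      finally have "norm (smul (q i * t - \<phi> z) p1) \<le> \<epsilon> / 2" by (simp add: norm_smul)
      then have "norm (smul (q i * t - \<phi> z) p1 + smul (t - \<psi> z) p2) < \<epsilon> / 2 + \<epsilon> / 2"
        using t(2) by (intro norm_triangle_lt) (simp add: norm_smul)
      then show ?thesis by (simp add: y_def dist_norm)
    qed
    ultimately show "\<exists>y\<in>Rec T. dist y z < \<epsilon>" by blast
  qed
  then have "closure (span (range e)) \<subseteq> closure (Rec T)"
    by (intro closure_minimal) auto
  then show ?thesis using dense_span by auto
qed

section \<open>Escaping vectors in every dense subspace\<close>

text \<open>Up to the time \<open>M (Suc k) / 6\<close> the rotation on the \<open>k\<close>-th plane stays within an angle of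
  \<open>pi / 3\<close>, so the added terms do not cancel: at least half of each contributes to the
  coordinate \<open>A k\<close>.\<close>

lemma escape_estimate:
  assumes "M k \<le> 6 * n" "6 * n \<le> M (Suc k)"
  shows "w k * norm (g k x) \<le> 12 * K k * (norm ((T ^^ n) x) + norm x)"
proof -
  let ?S = "\<Sum>l<n. cos (real l * \<theta> k)"
  let ?y = "(T ^^ n) x"
  have "real n * 6 \<le> M (Suc k)" using assms(2) by linarith
  then have "real n * \<theta> k \<le> pi / 3"
    using M_pos[of "Suc k"] by (simp add: \<theta>_def field_simps)
  then have "n / 2 \<le> ?S" using \<theta>_pos[of k] by (intro sum_cos_ge_half) auto
  then have "M k / 12 \<le> ?S" using assms(1) by linarith
  then have "c k * (M k / 12) \<le> c k * ?S" using c_nonneg by (intro mult_left_mono)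
  then have "w k / 12 \<le> c k * ?S" using M_pos[of k] by (simp add: c_def)
  then have "w k / 12 * norm (g k x) \<le> c k * ?S * norm (g k x)" by (intro mult_right_mono) auto
  also have "\<dots> \<le> norm (of_real (c k * ?S) * g k x)"
    unfolding norm_mult norm_of_real by (intro mult_right_mono) auto
  also have "of_real (c k * ?S) * g k x
      = A k ?y - (of_real (cos (real n * \<theta> k)) * A k x - of_real (sin (real n * \<theta> k)) * B k x)"
    unfolding A_iterate by simp
  also have "norm \<dots> \<le> norm (A k ?y) + (norm (A k x) + norm (B k x))"
  proof (intro norm_triangle_le_diff add_mono norm_triangle_le_diff order_refl)
    show "norm (of_real (cos (real n * \<theta> k)) * A k x) \<le> norm (A k x)"
      unfolding norm_mult norm_of_real by (intro mult_left_le_one_le) auto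
    show "norm (of_real (sin (real n * \<theta> k)) * B k x) \<le> norm (B k x)"
      unfolding norm_mult norm_of_real by (intro mult_left_le_one_le) auto
  qed
  also have "\<dots> \<le> K k * norm ?y + K k * norm x"
    using K_bound[of k ?y] K_bound[of k x] norm_ge_zero[of "B k ?y"] by linarith
  finally show ?thesis by (simp add: algebra_simps)
qed

text \<open>The time windows of the escape estimate cover all positive times, and \<open>w k\<close> was chosen such that
  the lower bounds they give tend to infinity for vectors of slope \<open>\<alpha>\<close>.\<close>

lemma escaping_point:
  assumes line: "\<phi> x = \<alpha> * \<psi> x" and nz: "\<psi> x \<noteq> 0"
  shows "x \<notin> Rec T"
proof (rule not_Rec_if_orbit_escapes, unfold filterlim_at_top, intro allI)
  fix Z :: real
  obtain m :: nat where m: "real m * norm (\<psi> x) \<ge> 12 * (Z + norm x)"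
    using ex_less_of_nat_mult[of "norm (\<psi> x)"] nz by (metis less_imp_le zero_less_norm_iff)
  have "Z \<le> norm ((T ^^ n) x)" if n: "n \<ge> M m" for n
  proof -
    have "\<exists>k. 6 * n \<le> M (Suc k)" using M_unbounded by (meson less_or_eq_imp_le Suc_leD less_eq_Suc_le)
    define k where "k = (LEAST k. 6 * n \<le> M (Suc k))"
    have upper: "6 * n \<le> M (Suc k)"
      unfolding k_def by (rule LeastI_ex) fact
    have lower: "M k \<le> 6 * n"
    proof (cases k)
      case 0
      then show ?thesis using n M_pos[of m] by (simp add: M_0)
    next
      case (Suc j)
      then have "\<not> 6 * n \<le> M (Suc j)"
        using not_less_Least[of j "\<lambda>k. 6 * n \<le> M (Suc k)"] unfolding k_def by simp
      then show ?thesis using Suc by simp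
    qed
    have "m \<le> k"
    proof (rule ccontr)
      assume "\<not> m \<le> k"
      then have "M (Suc k) \<le> M m" by (intro M_mono) auto
      then show False using upper n M_pos[of m] by linarith
    qed
    have "g k x = (\<alpha> - q k) * \<psi> x" by (simp add: g_def line algebra_simps)
    then have "w k * norm (g k x) = real k * K k * norm (\<psi> x)"
      using avoids[of k] by (simp add: w_def norm_mult)
    with escape_estimate[OF lower upper, of x]
    have "K k * (real k * norm (\<psi> x)) \<le> K k * (12 * (norm ((T ^^ n) x) + norm x))"
      by (simp add: algebra_simps)
    then have "real k * norm (\<psi> x) \<le> 12 * (norm ((T ^^ n) x) + norm x)"
      using K_ge_1[of k] by (subst (asm) mult_le_cancel_left_pos) auto
    moreover have "real m * norm (\<psi> x) \<le> real k * norm (\<psi> x)"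
      using \<open>m \<le> k\<close> by (intro mult_right_mono) auto
    ultimately have "12 * (Z + norm x) \<le> 12 * (norm ((T ^^ n) x) + norm x)"
      using m by (meson order_trans)
    then show ?thesis by simp
  qed
  then show "\<forall>\<^sub>F n in sequentially. Z \<le> norm ((T ^^ n) x)"
    by (auto simp: eventually_sequentially)
qed

text \<open>The first two coordinates map a dense subspace onto the whole plane: the determinant of two
  of its members cannot vanish identically, since it does not vanish at \<open>p1\<close>, \<open>p2\<close>. A vector of
  slope \<open>\<alpha>\<close> is then found by Cramer's rule.\<close>

lemma dense_subspace_meets_line:
  assumes V: "subspace V" "closure V = UNIV"
  obtains x where "x \<in> V" "\<phi> x = \<alpha> * \<psi> x" "\<psi> x \<noteq> 0"
proof -
  note cont = coordinate_dual(1,2)[THEN dual_space_continuous]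
  have "\<exists>x\<in>V. \<exists>y\<in>V. \<phi> x * \<psi> y - \<phi> y * \<psi> x \<noteq> 0"
  proof (rule ccontr)
    assume "\<not> ?thesis"
    then have zero: "\<phi> x * \<psi> y - \<phi> y * \<psi> x = 0" if "x \<in> V" "y \<in> V" for x y
      using that by blast
    have zero': "\<phi> x * \<psi> y - \<phi> y * \<psi> x = 0" if "x \<in> V" for x y
    proof (rule continuous_constant_on_closure[where S = V and f = "\<lambda>y. \<phi> x * \<psi> y - \<phi> y * \<psi> x"])
      show "continuous_on (closure V) (\<lambda>y. \<phi> x * \<psi> y - \<phi> y * \<psi> x)"
        by (intro continuous_intros cont)
    qed (use V in \<open>simp_all only: zero[OF that] UNIV_I\<close>)
    have "\<phi> x * \<psi> y - \<phi> y * \<psi> x = 0" for x y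
    proof (rule continuous_constant_on_closure[where S = V and f = "\<lambda>x. \<phi> x * \<psi> y - \<phi> y * \<psi> x"])
      show "continuous_on (closure V) (\<lambda>x. \<phi> x * \<psi> y - \<phi> y * \<psi> x)"
        by (intro continuous_intros cont)
    qed (use V in \<open>simp_all only: zero' UNIV_I\<close>)
    from this[of p1 p2] show False by (simp add: coordinate_values)
  qed
  then obtain x y where xy: "x \<in> V" "y \<in> V" "\<phi> x * \<psi> y - \<phi> y * \<psi> x \<noteq> 0" by blast
  define z where "z = smul (\<alpha> * \<psi> y - \<phi> y) x + smul (\<phi> x - \<alpha> * \<psi> x) y"
  have "z \<in> V"
    unfolding z_def using xy V by (intro subspace_add subspace_scale)
  moreover have "\<psi> z = \<phi> x * \<psi> y - \<phi> y * \<psi> x"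
    unfolding z_def coordinate_add coordinate_smul by (simp add: algebra_simps)
  moreover have "\<phi> z = \<alpha> * (\<phi> x * \<psi> y - \<phi> y * \<psi> x)"
    unfolding z_def coordinate_add coordinate_smul by (simp add: algebra_simps)
  ultimately show ?thesis using that xy(3) by metis
qed

theorem recurrent_not_dense_lineable:
  "recurrent_operator smul T \<and> \<not> dense_lineable smul (Rec T)"
proof
  show "recurrent_operator smul T"
    by (simp add: recurrent_operator_def T_bounded_operator dense_recurrent_points)
  show "\<not> dense_lineable smul (Rec T)"
  proof
    assume "dense_lineable smul (Rec T)"
    then obtain V where V: "subspace V" "closure V = UNIV" "V \<subseteq> Rec T"
      unfolding dense_lineable_def by blast
    then show False using dense_subspace_meets_line[OF V(1,2)] escaping_point by blast
  qed
qed

end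

section \<open>Existence over the real and the complex numbers\<close>

text \<open>A slope outside the countable set of listed ones exists because the scalar field contains
  the real numbers.\<close>

lemma dense_sequence_with_repetitions:
  obtains q :: "nat \<Rightarrow> 'k::{real_normed_field, second_countable_topology}" and \<alpha>
  where "closure (range q) = UNIV" "\<And>k. infinite {j. q j = q k}" "\<And>k. \<alpha> \<noteq> q k"
proof -
  obtain Q :: "'k set" where Q: "countable Q" "\<And>X. open X \<Longrightarrow> X \<noteq> {} \<Longrightarrow> \<exists>d\<in>Q. d \<in> X"
    by (rule countable_dense_setE) blast
  have "Q \<noteq> {}" using Q(2)[of UNIV] by auto
  have "closure Q = UNIV"
  proof (rule ccontr)
    assume "closure Q \<noteq> UNIV"
    then obtain d where "d \<in> Q" "d \<in> - closure Q" using Q(2)[of "- closure Q"] by auto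
    then show False using closure_subset by blast
  qed
  define q where "q n = from_nat_into Q (fst (prod_decode n))" for n
  have "range q = Q"
  proof -
    have "range q = from_nat_into Q ` fst ` range prod_decode" by (auto simp: q_def)
    also have "\<dots> = Q" using Q(1) \<open>Q \<noteq> {}\<close> by (simp add: surj_prod_decode range_from_nat_into)
    finally show ?thesis .
  qed
  have "infinite {j. q j = q k}" for k
  proof -
    let ?r = "\<lambda>i. prod_encode (fst (prod_decode k), i)"
    have "inj ?r" by (auto simp: inj_on_def)
    then have "infinite (range ?r)" by (rule range_inj_infinite)
    moreover have "range ?r \<subseteq> {j. q j = q k}" by (auto simp: q_def)
    ultimately show ?thesis using infinite_super by blast
  qed
  moreover have "\<not> range (of_real :: real \<Rightarrow> 'k) \<subseteq> Q"
  proof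
    assume "range (of_real :: real \<Rightarrow> 'k) \<subseteq> Q"
    then have "countable (range (of_real :: real \<Rightarrow> 'k))" using Q(1) by (rule countable_subset)
    then have "countable (UNIV :: real set)"
      by (rule countable_image_inj_on) (auto simp: inj_on_def)
    then show False using uncountable_UNIV_real by simp
  qed
  then obtain \<alpha> where "\<alpha> \<notin> Q" by blast
  ultimately show ?thesis
    using \<open>closure Q = UNIV\<close> \<open>range q = Q\<close> by (intro that[of q \<alpha>]) auto
qed

theorem recurrent_not_dense_lineable_exists:
  fixes smul :: "'k::{real_normed_field, second_countable_topology} \<Rightarrow> 'a::banach \<Rightarrow> 'a"
  assumes "banach_space_over smul" "separable_space (euclidean :: 'a topology)"
    "infinite_dimensional smul"
    and "\<And>x. x \<noteq> 0 \<Longrightarrow> \<exists>f\<in>banach_space_over.dual_space smul. f x \<noteq> 0"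
  shows "\<exists>T. recurrent_operator smul T \<and> \<not> dense_lineable smul (Rec T)"
proof -
  interpret banach_space_over smul by fact
  obtain e :: "nat \<Rightarrow> 'a" and f :: "nat \<Rightarrow> 'a \<Rightarrow> 'k" where ef: "\<And>n. f n \<in> dual_space" "\<And>i j. f i (e j) = (if i = j then 1 else 0)"
    "closure (span (range e)) = UNIV"
    by (rule fundamental_biorthogonal_sequence[OF assms(2-4)]) (assumption | rule that)+
  obtain q :: "nat \<Rightarrow> 'k" and \<alpha> where q: "closure (range q) = UNIV"
    "\<And>k. infinite {j. q j = q k}" "\<And>k. \<alpha> \<noteq> q k"
    by (rule dense_sequence_with_repetitions) (rule that)
  interpret rotation_shear smul e f q \<alpha>
    by unfold_locales (fact ef q)+
  show ?thesis by (rule exI, rule recurrent_not_dense_lineable)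
qed

theorem theorem2p1:
  fixes scaleC :: "complex \<Rightarrow> 'b::banach \<Rightarrow> 'b"
  shows
    "(separable_space (euclidean :: 'a::banach topology) \<and>
      infinite_dimensional (scaleR :: real \<Rightarrow> 'a \<Rightarrow> 'a) \<longrightarrow>
        (\<exists>T :: 'a \<Rightarrow> 'a. recurrent_operator scaleR T \<and> \<not> dense_lineable scaleR (Rec T)))
     \<and>
     (banach_space_over scaleC \<and>
      separable_space (euclidean :: 'b topology) \<and>
      infinite_dimensional scaleC \<longrightarrow>
        (\<exists>T :: 'b \<Rightarrow> 'b. recurrent_operator scaleC T \<and> \<not> dense_lineable scaleC (Rec T)))"
  using recurrent_not_dense_lineable_exists[OF banach_space_over_real _ _ real_dual_separates_points]
    recurrent_not_dense_lineable_exists[OF _ _ _ complex_dual_separates_points, of scaleC]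
  by blast

end
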